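(* Let $\mathcal{A}$ be the $n$-dimensional null-filiform associative algebra over $\mathbb{C}$ with basis $e_1,\dots,e_n$, and let $P_0$ be a homogeneous Average operator with degree $0$ on $\mathcal{A}$, with associated function $\psi$. Then: (a) If $\psi(t)\neq 0$ for some $1\le t\le\lfloor n/2\rfloor$, then \[P_0(e_i)=\begin{cases}\psi(t)e_i, & i\equiv 0 \ (\bmod\ t),\\ 0, & \text{otherwise;}\end{cases}\] (b) If $\psi(t)=0$ for all $1\le t\le\lfloor n/2\rfloor$, then \[P_0(e_i)=\begin{cases}\psi(r)e_r, & i=r,\\ 0, & \text{otherwise,}\end{cases}\] for some fixed $\lfloor n/2\rfloor<r\le n$.
   Context: The $n$-dimensional null-filiform associative algebra $\mathcal{A}$ over $\mathbb{C}$ has basis $e_1,\dots,e_n$ and bilinear product $e_ie_j=e_{i+j}$ if $i+j\le n$, and $e_ie_j=0$ otherwise. A homogeneous operator of degree $0$ on $\mathcal{A}$ is a linear map $P_0$ with $P_0(e_i)=\psi(i)e_i$ for $1\le i\le n$, where $\psi:\mathbb{N}\to\mathbb{C}$ is a function. An Average operator is a linear map $P:\mathcal{A}\to\mathcal{A}$ with $P(x)P(y)=P(xP(y))$ for all $x,y\in\mathcal{A}$.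
   Formalization: In (a) the formula is proved for some t ≤ ⌊n/2⌋ with ψ(t) ≠ 0 (necessarily the least such t), not for every such t: for P₀ the identity, n = 4, t = 2 the formula fails at e₁. *)

theory Defs
  imports Complex_Main "HOL-Number_Theory.Cong"
begin

locale complex_associative_algebra = vector_space scale
  for scale :: "complex \<Rightarrow> 'a::ab_group_add \<Rightarrow> 'a" +
  fixes mul :: "'a \<Rightarrow> 'a \<Rightarrow> 'a"
  assumes linear_mul_right: "Vector_Spaces.linear scale scale (\<lambda>y. mul x y)"
    and linear_mul_left: "Vector_Spaces.linear scale scale (\<lambda>x. mul x y)"
    and mul_assoc: "mul (mul x y) z = mul x (mul y z)"

text \<open>The whole type is the algebra, and only the values of \<open>e\<close> on \<open>{1..n}\<close> matter;
  injectivity is needed for the \<open>e i\<close> to be \<open>n\<close> distinct vectors, since independence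
  and span only see the set of values.\<close>

locale null_filiform_algebra = complex_associative_algebra scale mul
  for scale :: "complex \<Rightarrow> 'a::ab_group_add \<Rightarrow> 'a" and mul :: "'a \<Rightarrow> 'a \<Rightarrow> 'a" +
  fixes n :: nat and e :: "nat \<Rightarrow> 'a"
  assumes dim_pos: "1 \<le> n"
    and basis_inj: "inj_on e {1..n}"
    and basis_independent: "independent (e ` {1..n})"
    and basis_span: "span (e ` {1..n}) = UNIV"
    and basis_mul: "\<lbrakk>i \<in> {1..n}; j \<in> {1..n}\<rbrakk>
      \<Longrightarrow> mul (e i) (e j) = (if i + j \<le> n then e (i + j) else 0)"

definition homogeneous_degree_0 ::
  "(complex \<Rightarrow> 'a::ab_group_add \<Rightarrow> 'a) \<Rightarrow> nat \<Rightarrow> (nat \<Rightarrow> 'a) \<Rightarrow> (nat \<Rightarrow> complex) \<Rightarrow> ('a \<Rightarrow> 'a) \<Rightarrow> bool"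
  where "homogeneous_degree_0 scale n e \<psi> P \<longleftrightarrow>
    Vector_Spaces.linear scale scale P \<and> (\<forall>i\<in>{1..n}. P (e i) = scale (\<psi> i) (e i))"

definition average_operator ::
  "(complex \<Rightarrow> 'a::ab_group_add \<Rightarrow> 'a) \<Rightarrow> ('a \<Rightarrow> 'a \<Rightarrow> 'a) \<Rightarrow> ('a \<Rightarrow> 'a) \<Rightarrow> bool"
  where "average_operator scale mul P \<longleftrightarrow>
    Vector_Spaces.linear scale scale P \<and> (\<forall>x y. mul (P x) (P y) = P (mul x (P y)))"

end

theory Submission imports Defs begin

text \<open>On basis vectors the averaging identity says \<open>\<psi> i = \<psi> (i + j)\<close> whenever \<open>\<psi> j \<noteq> 0\<close> and
  \<open>i + j \<le> n\<close>. In case (a), let \<open>t\<close> be the least index with \<open>\<psi> t \<noteq> 0\<close>: then \<open>\<psi>\<close> is \<open>t\<close>-periodic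
  and vanishes below \<open>t\<close>. In case (b), let \<open>r\<close> be the least index in \<open>{1..n}\<close> with \<open>\<psi> r \<noteq> 0\<close>:
  any \<open>r + i \<le> n\<close> has \<open>i \<le> n div 2\<close>, so \<open>\<psi> (r + i) = \<psi> i = 0\<close>. If \<open>\<psi>\<close> vanishes on \<open>{1..n}\<close>,
  every admissible \<open>r\<close> works.\<close>

text \<open>At \<open>x = e i\<close>, \<open>y = e j\<close> both sides of the averaging identity
  are multiples of \<open>e (i + j)\<close>, which is nonzero by independence; comparing
  coefficients and cancelling \<open>\<psi> j\<close> gives the claim.\<close>

lemma average_operator_weight_shift:
  assumes "null_filiform_algebra scale mul n e"
    and "homogeneous_degree_0 scale n e \<psi> P"
    and "average_operator scale mul P"
    and "1 \<le> i" "1 \<le> j" "i + j \<le> n" "\<psi> j \<noteq> 0"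
  shows "\<psi> i = \<psi> (i + j)"
proof -
  interpret null_filiform_algebra scale mul n e by fact
  interpret L: Vector_Spaces.linear scale scale "\<lambda>x. mul x y" for y
    by (rule linear_mul_left)
  interpret R: Vector_Spaces.linear scale scale "\<lambda>y. mul x y" for x
    by (rule linear_mul_right)
  interpret P: Vector_Spaces.linear scale scale P
    using assms(2) by (simp add: homogeneous_degree_0_def)
  have ij: "i \<in> {1..n}" "j \<in> {1..n}" "i + j \<in> {1..n}"
    using assms(4-6) by auto
  have P: "P (e k) = scale (\<psi> k) (e k)" if "k \<in> {1..n}" for k
    using assms(2) that by (simp add: homogeneous_degree_0_def)
  have m: "mul (e i) (e j) = e (i + j)"
    using basis_mul[OF ij(1,2)] assms(6) by simp
  have "scale (\<psi> j * \<psi> i) (e (i + j)) = mul (P (e i)) (P (e j))"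
    unfolding P[OF ij(1)] P[OF ij(2)] L.scale R.scale m scale_scale ..
  also have "\<dots> = P (mul (e i) (P (e j)))"
    using assms(3) by (simp add: average_operator_def)
  also have "\<dots> = scale (\<psi> j * \<psi> (i + j)) (e (i + j))"
    unfolding P[OF ij(2)] R.scale m P.scale P[OF ij(3)] scale_scale ..
  finally have "scale (\<psi> j * \<psi> i) (e (i + j)) = scale (\<psi> j * \<psi> (i + j)) (e (i + j))" .
  moreover have "e (i + j) \<noteq> 0"
    using basis_independent dependent_zero ij(3) by (metis imageI)
  ultimately show ?thesis
    using assms(7) by simp
qed

text \<open>Bounding the endpoint suffices: all intermediate points lie between \<open>i\<close> and
  \<open>i + k * t\<close>, so \<open>shift\<close> applies at each step.\<close>

lemma periodic_on_multiple:
  fixes f :: "nat \<Rightarrow> 'b"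
  assumes shift: "\<And>i. 1 \<le> i \<Longrightarrow> i + t \<le> n \<Longrightarrow> f i = f (i + t)"
    and "1 \<le> i" "i + k * t \<le> n"
  shows "f (i + k * t) = f i"
  using assms(3)
proof (induction k)
  case (Suc k)
  then have "f (i + k * t) = f (i + k * t + t)"
    using shift[of "i + k * t"] \<open>1 \<le> i\<close> by (simp add: algebra_simps)
  with Suc show ?case by (simp add: algebra_simps)
qed simp

text \<open>Case (a) asserts that a suitable \<open>t\<close> exists, since the formula can fail at
  a non-minimal index: take the identity operator with \<open>n = 4\<close> and
  \<open>t = 2\<close>.\<close>

theorem theorem3p16:
  fixes scale :: "complex \<Rightarrow> 'a::ab_group_add \<Rightarrow> 'a"
    and mul :: "'a \<Rightarrow> 'a \<Rightarrow> 'a"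
    and n :: nat
    and e :: "nat \<Rightarrow> 'a"
    and \<psi> :: "nat \<Rightarrow> complex"
    and P\<^sub>0 :: "'a \<Rightarrow> 'a"
  assumes "null_filiform_algebra scale mul n e"
    and "homogeneous_degree_0 scale n e \<psi> P\<^sub>0"
    and "average_operator scale mul P\<^sub>0"
  shows "((\<exists>t\<in>{1..n div 2}. \<psi> t \<noteq> 0) \<longrightarrow>
           (\<exists>t\<in>{1..n div 2}. \<psi> t \<noteq> 0 \<and>
             (\<forall>i\<in>{1..n}. P\<^sub>0 (e i) = (if [i = 0] (mod t) then scale (\<psi> t) (e i) else 0)))) \<and>
         ((\<forall>t\<in>{1..n div 2}. \<psi> t = 0) \<longrightarrow>
           (\<exists>r. n div 2 < r \<and> r \<le> n \<and>
             (\<forall>i\<in>{1..n}. P\<^sub>0 (e i) = (if i = r then scale (\<psi> r) (e r) else 0))))"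
proof (intro conjI impI)
  note shift = average_operator_weight_shift[OF assms]
  interpret null_filiform_algebra scale mul n e by fact
  have P: "P\<^sub>0 (e i) = scale (\<psi> i) (e i)" if "i \<in> {1..n}" for i
    using assms(2) that by (simp add: homogeneous_degree_0_def)
  {
    assume "\<exists>t\<in>{1..n div 2}. \<psi> t \<noteq> 0"
    then obtain t where t: "t \<in> {1..n div 2}" "\<psi> t \<noteq> 0"
      and least: "\<forall>s<t. \<not> (s \<in> {1..n div 2} \<and> \<psi> s \<noteq> 0)"
      using exists_least_iff[of "\<lambda>t. t \<in> {1..n div 2} \<and> \<psi> t \<noteq> 0"] by auto
    have below: "\<psi> s = 0" if "1 \<le> s" "s < t" for s
      using least that t(1) by auto
    have periodic: "\<psi> (i + k * t) = \<psi> i" if "1 \<le> i" "i + k * t \<le> n" for i k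
      by (rule periodic_on_multiple[of t n]) (use shift t that in auto)
    have "\<psi> i = (if [i = 0] (mod t) then \<psi> t else 0)" if i: "i \<in> {1..n}" for i
    proof (cases "[i = 0] (mod t)")
      case True
      then obtain q where "i = q * t"
        by (metis cong_0_iff dvdE mult.commute)
      \<comment> \<open>The shift starts only at index 1 and \<open>\<psi> 0\<close> is
        unconstrained, so multiples of \<open>t\<close> are compared with \<open>t\<close> itself,
        not with 0.\<close>
      with i obtain k where "i = t + k * t"
        by (cases q) auto
      with True i t periodic[of t k] show ?thesis by simp
    next
      case False
      then have "i mod t \<noteq> 0" by (simp add: cong_def)
      \<comment> \<open>The nonzero residue lies strictly between 0 and \<open>t\<close>, where
        \<psi> vanishes by minimality.\<close>
      moreover have "\<psi> (i mod t + i div t * t) = \<psi> (i mod t)"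
        using periodic[of "i mod t" "i div t"] i \<open>i mod t \<noteq> 0\<close> by simp
      ultimately show ?thesis
        using False below[of "i mod t"] t by simp
    qed
    then have "\<forall>i\<in>{1..n}. P\<^sub>0 (e i) = (if [i = 0] (mod t) then scale (\<psi> t) (e i) else 0)"
      using P by simp
    with t show "\<exists>t\<in>{1..n div 2}. \<psi> t \<noteq> 0 \<and>
      (\<forall>i\<in>{1..n}. P\<^sub>0 (e i) = (if [i = 0] (mod t) then scale (\<psi> t) (e i) else 0))"
      by blast
  next
    assume low: "\<forall>t\<in>{1..n div 2}. \<psi> t = 0"
    have "\<exists>r. n div 2 < r \<and> r \<le> n \<and> (\<forall>i\<in>{1..n}. i \<noteq> r \<longrightarrow> \<psi> i = 0)"
    proof (cases "\<exists>r\<in>{1..n}. \<psi> r \<noteq> 0")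
      case True
      then obtain r where r: "r \<in> {1..n}" "\<psi> r \<noteq> 0"
        and least: "\<forall>s<r. \<not> (s \<in> {1..n} \<and> \<psi> s \<noteq> 0)"
        using exists_least_iff[of "\<lambda>r. r \<in> {1..n} \<and> \<psi> r \<noteq> 0"] by auto
      have large: "n div 2 < r"
        using low r by (meson atLeastAtMost_iff not_le)
      have "\<psi> i = 0" if i: "i \<in> {1..n}" "i \<noteq> r" for i
      proof (cases "i < r")
        case True
        then show ?thesis
          using least i by blast
      next
        case False
        then have "\<psi> (i - r) = \<psi> (i - r + r)"
          using shift[of "i - r" r] i r by simp
        \<comment> \<open>For either parity of \<open>n\<close>, \<open>r \<ge> n div 2 + 1\<close>
          gives \<open>i - r \<le> n - n div 2 - 1 \<le> n div 2\<close>.\<close>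
        moreover have "i - r \<in> {1..n div 2}"
          using False i large by auto
        ultimately show ?thesis
          using low False by simp
      qed
      with large r show ?thesis by auto
    next
      case False
      \<comment> \<open>Here \<psi> is zero on \<open>{1..n}\<close>; \<open>r = n\<close> is
        admissible because \<open>n div 2 < n\<close> for positive \<open>n\<close>.\<close>
      with dim_pos show ?thesis by (intro exI[of _ n]) auto
    qed
    then obtain r where "n div 2 < r" "r \<le> n" "\<forall>i\<in>{1..n}. i \<noteq> r \<longrightarrow> \<psi> i = 0"
      by blast
    then show "\<exists>r. n div 2 < r \<and> r \<le> n \<and>
      (\<forall>i\<in>{1..n}. P\<^sub>0 (e i) = (if i = r then scale (\<psi> r) (e r) else 0))"
      using P by (intro exI[of _ r]) auto
  }
qed

end
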